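(* Let $n\ge 1$ be an integer, let $r_1,\dots,r_n$ be positive integers, and let $x_i$ ($1\le i\le n$) and $\tau_{ij}$ ($1\le i\le n$, $1\le j\le r_i$) be real numbers such that the numbers $\tau_{ij}x_i$ ($1\le i\le n$, $1\le j\le r_i$) are non-negative and pairwise distinct (i.e. $\tau_{ij}x_i\ne\tau_{k\ell}x_k$ whenever $(i,j)\neq(k,\ell)$). Put $m:=\sum_{i=1}^n r_i$ and, for $1\le i\le n$ and $1\le j\le r_i$, $$a_{ij}:=\frac{\left(\prod_{1\le k\le n,\ k\neq i}\left(x_k^{r_k}\prod_{\ell=1}^{r_k}\tau_{k\ell}\right)\right)\left(\prod_{1\le \ell\le r_i,\ \ell\neq j}\tau_{i\ell}\right)}{\left(\prod_{1\le k\le n,\ k\neq i}\ \prod_{\ell=1}^{r_k}(\tau_{k\ell}x_k-\tau_{ij}x_i)\right)\left(\prod_{1\le \ell\le r_i,\ \ell\neq j}(\tau_{i\ell}-\tau_{ij})\right)}.$$ Then $$\prod_{i=1}^n\prod_{j=1}^{r_i}(1+\tau_{ij}x_i)^{a_{ij}}\leq \exp\left(\frac{1}{m}\prod_{i=1}^n\left(x_i^{r_i}\prod_{j=1}^{r_i}\tau_{ij}\right)\right).$$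
   Context: Empty products are equal to $1$. The exponents $a_{ij}$ are real numbers, and $(1+\tau_{ij}x_i)^{a_{ij}}$ denotes the real power of the positive real number $1+\tau_{ij}x_i$. *)

theory Defs
  imports Complex_Main
begin

definition expo :: "nat \<Rightarrow> (nat \<Rightarrow> nat) \<Rightarrow> (nat \<Rightarrow> real) \<Rightarrow> (nat \<Rightarrow> nat \<Rightarrow> real) \<Rightarrow> nat \<Rightarrow> nat \<Rightarrow> real"
  where "expo n r x \<tau> i j =
    ((\<Prod>k\<in>{1..n} - {i}. x k ^ r k * (\<Prod>l=1..r k. \<tau> k l)) * (\<Prod>l\<in>{1..r i} - {j}. \<tau> i l))
    / ((\<Prod>k\<in>{1..n} - {i}. \<Prod>l=1..r k. (\<tau> k l * x k - \<tau> i j * x i))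
       * (\<Prod>l\<in>{1..r i} - {j}. (\<tau> i l - \<tau> i j)))"

end

theory Submission
  imports Defs "HOL-Computational_Algebra.Polynomial"
begin

text \<open>
  Write \<open>y\<^sub>p\<close> for the numbers \<open>\<tau>\<^sub>i\<^sub>j x\<^sub>i\<close>, \<open>p = (i, j)\<close>. The exponents are the Lagrange
  weights \<open>a\<^sub>p = \<Prod>\<^bsub>q \<noteq> p\<^esub> y\<^sub>q / (y\<^sub>q - y\<^sub>p)\<close>. Put \<open>F s = \<Sum>\<^sub>p a\<^sub>p ln (1 + s y\<^sub>p)\<close>. Lagrange
  interpolation of the constant \<open>1\<close> at the nodes \<open>1 + s y\<^sub>p\<close>, evaluated at \<open>0\<close>, shows that
  \<open>F' s = s\<^bsup>m-1\<^esup> \<Prod>\<^sub>q y\<^sub>q / (1 + s y\<^sub>q) \<le> s\<^bsup>m-1\<^esup> \<Prod>\<^sub>q y\<^sub>q\<close> for \<open>s > 0\<close>, and comparing \<open>F\<close>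
  with the antiderivative of the bound on \<open>[0, 1]\<close> yields the claim.
\<close>

text \<open>The summands are the values at \<open>0\<close> of the Lagrange basis polynomials for
  the nodes \<open>z p\<close>. These polynomials add up to the constant \<open>1\<close>, since
  their sum takes the value \<open>1\<close> at \<open>card A\<close> distinct nodes and has smaller
  degree.\<close>

lemma sum_lagrange_weights_eq_1:
  fixes z :: "'a \<Rightarrow> 'b::field"
  assumes "finite A" "A \<noteq> {}" "inj_on z A"
  shows "(\<Sum>p\<in>A. \<Prod>q\<in>A - {p}. z q / (z q - z p)) = 1"
proof -
  define L where "L p = (\<Prod>q\<in>A - {p}. smult (1 / (z p - z q)) [:- z q, 1:])" for p
  have poly_L: "poly (L p) t = (\<Prod>q\<in>A - {p}. (t - z q) / (z p - z q))" for p t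
    by (simp add: L_def poly_prod diff_divide_distrib)
  have card: "card A > 0"
    using assms by (simp add: card_gt_0_iff)
  have "degree (L p) \<le> card A - 1" if "p \<in> A" for p
  proof -
    have "degree (L p) \<le> (\<Sum>q\<in>A - {p}. 1)"
      unfolding L_def using assms
      by (intro order.trans[OF degree_prod_sum_le] sum_mono) (auto simp: o_def)
    then show ?thesis
      using that assms by simp
  qed
  then have "degree (\<Sum>p\<in>A. L p) \<le> card A - 1"
    by (intro degree_sum_le) (use assms in auto)
  \<comment> \<open>The strict bound relies on \<open>A\<close> being nonempty, as subtraction on
    \<open>nat\<close> truncates at \<open>0\<close>.\<close>
  then have deg: "degree (\<Sum>p\<in>A. L p) < card A"
    using card by simp
  have node: "poly (\<Sum>p\<in>A. L p) (z k) = 1" if k: "k \<in> A" for k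
  proof -
    have "poly (L p) (z k) = (if p = k then 1 else 0)" if p: "p \<in> A" for p
    proof (cases "p = k")
      case True
      have "z k \<noteq> z q" if "q \<in> A - {k}" for q
        using assms k that by (auto dest: inj_onD)
      then show ?thesis
        using True by (simp add: poly_L)
    next
      case False
      \<comment> \<open>The factor with \<open>q = k\<close> vanishes.\<close>
      then show ?thesis
        using assms k by (auto simp: poly_L intro!: prod_zero)
    qed
    then have "(\<Sum>p\<in>A. poly (L p) (z k)) = (\<Sum>p\<in>A. if p = k then 1 else 0)"
      by (intro sum.cong) auto
    then show ?thesis
      using assms k by (simp add: poly_sum)
  qed
  have "(\<Sum>p\<in>A. L p) = 1"
    by (rule poly_eqI_degree[where A = "z ` A"])
      (use node deg card assms in \<open>auto simp: card_image\<close>)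
  then have "poly (\<Sum>p\<in>A. L p) 0 = 1"
    by simp
  moreover have "poly (L p) 0 = (\<Prod>q\<in>A - {p}. z q / (z q - z p))" for p
    unfolding poly_L by (intro prod.cong refl) (metis diff_0 minus_diff_eq minus_divide_divide)
  ultimately show ?thesis
    by (simp add: poly_sum)
qed

text \<open>Passing to the nodes \<open>1 + s * y q\<close> multiplies all differences by
  \<open>s\<close>, so each summand is a factor independent of \<open>p\<close> times a Lagrange
  weight at the new nodes, and those weights sum to \<open>1\<close>.\<close>

lemma sum_lagrange_weights_partial_fractions:
  fixes y :: "'a \<Rightarrow> 'b::field"
  assumes "finite A" "A \<noteq> {}" "inj_on y A" "s \<noteq> 0" "\<And>p. p \<in> A \<Longrightarrow> 1 + s * y p \<noteq> 0"
  shows "(\<Sum>p\<in>A. (\<Prod>q\<in>A - {p}. y q / (y q - y p)) * (y p / (1 + s * y p)))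
    = s ^ (card A - 1) * (\<Prod>q\<in>A. y q / (1 + s * y q))"
proof -
  define z where "z q = 1 + s * y q" for q
  have inj: "inj_on z A"
    using assms by (auto simp: inj_on_def z_def)
  have "(\<Prod>q\<in>A - {p}. y q / (y q - y p)) * (y p / z p)
      = s ^ (card A - 1) * (\<Prod>q\<in>A. y q / z q) * (\<Prod>q\<in>A - {p}. z q / (z q - z p))"
    if p: "p \<in> A" for p
  proof -
    have "(\<Prod>q\<in>A - {p}. y q / (y q - y p))
        = (\<Prod>q\<in>A - {p}. s * (y q / z q) * (z q / (z q - z p)))"
    proof (intro prod.cong refl)
      fix q assume q: "q \<in> A - {p}"
      have "z q - z p = s * (y q - y p)"
        by (simp add: z_def algebra_simps)
      moreover have "z q \<noteq> 0"
        using assms q by (simp add: z_def)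
      ultimately show "y q / (y q - y p) = s * (y q / z q) * (z q / (z q - z p))"
        using assms by simp
    qed
    also have "\<dots> = s ^ (card A - 1) * (\<Prod>q\<in>A - {p}. y q / z q)
        * (\<Prod>q\<in>A - {p}. z q / (z q - z p))"
      using assms p by (simp only: prod.distrib prod_constant) simp
    \<comment> \<open>The extra factor \<open>y p / z p\<close> completes the product over
      \<open>A - {p}\<close> to one over \<open>A\<close>.\<close>
    finally show ?thesis
      using assms p by (simp add: prod.remove[of A p "\<lambda>q. y q / z q"] mult_ac)
  qed
  then have "(\<Sum>p\<in>A. (\<Prod>q\<in>A - {p}. y q / (y q - y p)) * (y p / z p))
      = s ^ (card A - 1) * (\<Prod>q\<in>A. y q / z q)
        * (\<Sum>p\<in>A. \<Prod>q\<in>A - {p}. z q / (z q - z p))"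
    by (simp add: sum_distrib_left)
  then show ?thesis
    using sum_lagrange_weights_eq_1[OF assms(1,2) inj] by (simp add: z_def)
qed

lemma sum_lagrange_weights_ln_le:
  fixes y :: "'a \<Rightarrow> real"
  assumes "finite A" "A \<noteq> {}" "inj_on y A" and nonneg: "\<And>p. p \<in> A \<Longrightarrow> y p \<ge> 0"
  shows "(\<Sum>p\<in>A. (\<Prod>q\<in>A - {p}. y q / (y q - y p)) * ln (1 + y p))
    \<le> (\<Prod>p\<in>A. y p) / real (card A)"
proof -
  define a where "a p = (\<Prod>q\<in>A - {p}. y q / (y q - y p))" for p
  define P where "P = (\<Prod>p\<in>A. y p)"
  define m where "m = card A"
  \<comment> \<open>The subtracted term is the antiderivative of \<open>P * s ^ (m - 1)\<close> that
    vanishes at \<open>0\<close>; thus \<open>G 0 = 0\<close> and the claim reads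
    \<open>G 1 \<le> 0\<close>.\<close>
  define G where "G s = (\<Sum>p\<in>A. a p * ln (1 + s * y p)) - P * s ^ m / real m" for s
  have m: "m > 0"
    using assms by (simp add: m_def card_gt_0_iff)
  have pos: "1 + s * y p > 0" if "s \<ge> 0" "p \<in> A" for s p
    using that nonneg by (simp add: add_pos_nonneg)
  have deriv: "(G has_real_derivative
      (\<Sum>p\<in>A. a p * (y p / (1 + s * y p))) - P * s ^ (m - 1)) (at s)" if "s \<ge> 0" for s
    unfolding G_def
    by (rule derivative_eq_intros refl | use that pos m in force)+ (use m in \<open>simp add: mult.commute\<close>)
  have "G 0 \<ge> G 1"
  \<comment> \<open>The sign of the derivative is checked on the open interval only, because the
    partial fraction identity assumes \<open>s \<noteq> 0\<close>.\<close>
  proof (rule DERIV_nonpos_imp_decreasing_open[of 0 1 G])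
    show "continuous_on {0..1} G"
      by (intro continuous_at_imp_continuous_on ballI DERIV_isCont[OF deriv]) auto
    fix s :: real
    assume s: "0 < s" "s < 1"
    have "1 + s * y p \<noteq> 0" if "p \<in> A" for p
      using pos[of s p] s that by simp
    then have "(\<Sum>p\<in>A. a p * (y p / (1 + s * y p)))
        = s ^ (m - 1) * (\<Prod>q\<in>A. y q / (1 + s * y q))"
      unfolding a_def m_def using assms s
      by (intro sum_lagrange_weights_partial_fractions) auto
    also have "\<dots> \<le> s ^ (m - 1) * P"
    proof -
      have "0 \<le> y q / (1 + s * y q) \<and> y q / (1 + s * y q) \<le> y q" if "q \<in> A" for q
        using nonneg[OF that] s pos[of s q] that
        by (simp add: divide_le_eq mult_le_cancel_left1)
      then show ?thesis
        unfolding P_def using s by (intro mult_left_mono prod_mono) auto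
    qed
    finally show "\<exists>d. (G has_real_derivative d) (at s) \<and> d \<le> 0"
      using deriv[of s] s by (auto simp: mult.commute)
  qed simp
  then show ?thesis
    using m by (simp add: G_def a_def P_def m_def power_0_left)
qed

text \<open>
  If \<open>x i = 0\<close>, the distinctness of the \<open>\<tau> i j * x i\<close> forces \<open>r i = 1\<close>, so the factors
  \<open>\<tau> i l - \<tau> i j\<close>, which lack the scaling by \<open>x i\<close>, only occur when \<open>x i \<noteq> 0\<close>.
\<close>
lemma expo_eq_lagrange_weight:
  fixes n :: nat and r :: "nat \<Rightarrow> nat" and x :: "nat \<Rightarrow> real" and \<tau> :: "nat \<Rightarrow> nat \<Rightarrow> real"
  defines "A \<equiv> (SIGMA i:{1..n}. {1..r i})"
  defines "y \<equiv> (\<lambda>(i, j). \<tau> i j * x i)"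
  assumes inj: "inj_on y A" and i: "i \<in> {1..n}" and j: "j \<in> {1..r i}"
  shows "expo n r x \<tau> i j = (\<Prod>q\<in>A - {(i, j)}. y q / (y q - y (i, j)))"
proof -
  let ?f = "\<lambda>q. y q / (y q - y (i, j))"
  \<comment> \<open>Row \<open>i\<close> is split off: there \<open>x i\<close> cancels from each
    quotient, whereas in the other rows the numerators keep \<open>x k\<close> and yield
    \<open>x k ^ r k\<close>.\<close>
  have "A - {(i, j)} = (SIGMA k:{1..n} - {i}. {1..r k}) \<union> (\<lambda>l. (i, l)) ` ({1..r i} - {j})"
    using i by (auto simp: A_def)
  then have "prod ?f (A - {(i, j)})
      = prod ?f (SIGMA k:{1..n} - {i}. {1..r k}) * prod ?f ((\<lambda>l. (i, l)) ` ({1..r i} - {j}))"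
    by (simp, intro prod.union_disjoint) auto
  also have "prod ?f (SIGMA k:{1..n} - {i}. {1..r k})
      = (\<Prod>k\<in>{1..n} - {i}. \<Prod>l=1..r k. \<tau> k l * x k / (\<tau> k l * x k - \<tau> i j * x i))"
    by (subst prod.Sigma) (auto simp: y_def case_prod_unfold)
  also have "\<dots> = (\<Prod>k\<in>{1..n} - {i}. x k ^ r k * (\<Prod>l=1..r k. \<tau> k l))
      / (\<Prod>k\<in>{1..n} - {i}. \<Prod>l=1..r k. \<tau> k l * x k - \<tau> i j * x i)"
    by (simp add: prod_dividef prod.distrib mult.commute)
  also have "prod ?f ((\<lambda>l. (i, l)) ` ({1..r i} - {j}))
      = (\<Prod>l\<in>{1..r i} - {j}. \<tau> i l / (\<tau> i l - \<tau> i j))"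
  proof (subst prod.reindex)
    show "inj_on (\<lambda>l. (i, l)) ({1..r i} - {j})"
      by (simp add: inj_on_def)
    have "y (i, l) / (y (i, l) - y (i, j)) = \<tau> i l / (\<tau> i l - \<tau> i j)"
      if l: "l \<in> {1..r i} - {j}" for l
    proof -
      have "y (i, l) \<noteq> y (i, j)"
        using inj_onD[OF inj, of "(i, l)" "(i, j)"] i j l by (auto simp: A_def)
      then have "x i \<noteq> 0"
        by (auto simp: y_def)
      then show ?thesis
        by (simp add: y_def flip: left_diff_distrib)
    qed
    then show "prod (?f \<circ> (\<lambda>l. (i, l))) ({1..r i} - {j})
        = (\<Prod>l\<in>{1..r i} - {j}. \<tau> i l / (\<tau> i l - \<tau> i j))"
      by (intro prod.cong) auto
  qed
  finally show ?thesis
    by (simp add: expo_def prod_dividef)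
qed

theorem mainTheorem2:
  fixes n m :: nat
    and r :: "nat \<Rightarrow> nat"
    and x :: "nat \<Rightarrow> real"
    and \<tau> :: "nat \<Rightarrow> nat \<Rightarrow> real"
  assumes "n \<ge> 1"
    and "\<And>i. i \<in> {1..n} \<Longrightarrow> r i > 0"
    and "\<And>i j. i \<in> {1..n} \<Longrightarrow> j \<in> {1..r i} \<Longrightarrow> \<tau> i j * x i \<ge> 0"
    and "inj_on (\<lambda>(i, j). \<tau> i j * x i) (SIGMA i:{1..n}. {1..r i})"
    and "m = (\<Sum>i=1..n. r i)"
  shows "(\<Prod>i=1..n. \<Prod>j=1..r i. (1 + \<tau> i j * x i) powr expo n r x \<tau> i j)
    \<le> exp (1 / real m * (\<Prod>i=1..n. x i ^ r i * (\<Prod>j=1..r i. \<tau> i j)))"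
proof -
  define A where "A = (SIGMA i:{1..n}. {1..r i})"
  define y where "y = (\<lambda>(i, j). \<tau> i j * x i)"
  define a where "a p = (\<Prod>q\<in>A - {p}. y q / (y q - y p))" for p
  have fin: "finite A"
    by (simp add: A_def)
  have "(1, 1) \<in> A"
    using assms(1) assms(2)[of 1] by (simp add: A_def)
  then have ne: "A \<noteq> {}"
    by blast
  have inj: "inj_on y A"
    using assms(4) by (simp add: A_def y_def)
  have nonneg: "y p \<ge> 0" if "p \<in> A" for p
    using assms(3) that by (auto simp: A_def y_def)
  have card: "card A = m"
    by (simp add: A_def assms(5))
  have "(\<Prod>i=1..n. \<Prod>j=1..r i. (1 + \<tau> i j * x i) powr expo n r x \<tau> i j)
      = (\<Prod>i=1..n. \<Prod>j=1..r i. (1 + y (i, j)) powr a (i, j))"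
    using expo_eq_lagrange_weight[OF assms(4)]
    by (intro prod.cong refl) (simp add: a_def A_def y_def)
  also have "\<dots> = (\<Prod>p\<in>A. (1 + y p) powr a p)"
    unfolding A_def by (subst prod.Sigma) (auto simp: case_prod_unfold)
  also have "\<dots> = (\<Prod>p\<in>A. exp (a p * ln (1 + y p)))"
  proof (intro prod.cong refl)
    fix p assume "p \<in> A"
    \<comment> \<open>A nonzero base is needed since \<open>0 powr a\<close> is \<open>0\<close> by
      convention.\<close>
    then have "1 + y p \<noteq> 0"
      using nonneg[of p] by simp
    then show "(1 + y p) powr a p = exp (a p * ln (1 + y p))"
      by (simp add: powr_def)
  qed
  also have "\<dots> = exp (\<Sum>p\<in>A. a p * ln (1 + y p))"
    using fin by (simp add: exp_sum)
  also have "\<dots> \<le> exp ((\<Prod>p\<in>A. y p) / real (card A))"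
    unfolding a_def using sum_lagrange_weights_ln_le[OF fin ne inj nonneg] by simp
  also have "(\<Prod>p\<in>A. y p) = (\<Prod>i=1..n. \<Prod>j=1..r i. \<tau> i j * x i)"
    unfolding A_def y_def by (subst prod.Sigma) auto
  also have "\<dots> = (\<Prod>i=1..n. x i ^ r i * (\<Prod>j=1..r i. \<tau> i j))"
    by (simp add: prod.distrib mult.commute)
  finally show ?thesis
    by (simp add: card)
qed

end
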